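(* Let $(R,\mathfrak{m},K)$ be a finite local commutative ring with residue field $K=\mathbb{F}_q$, let $n\ge 1$, and let $C\subseteq R^n$ be an $R$-code. Then for every $0\le i\le n$, $$g^C_i(q)=A^C_i .$$
   Context: All rings are commutative with unity. An $R$-code of length $n$ is an $R$-submodule $C\subseteq R^n$. $\lambda(M)$ denotes the length of an $R$-module $M$. Let $[n]=\{1,\dots,n\}$ and $\operatorname{supp}(v)=\{i : v_i\ne 0\}$. For $\mathcal{A}\subseteq[n]$, $C(\mathcal{A})=\{v\in C : \operatorname{supp}(v)\subseteq\mathcal{A}\}$. For $0\le i\le n$ the $i$-th weight polynomial is $$g^C_i(z)=\sum_{a=0}^{i}\ \sum_{\mathcal{A}\subseteq[n],\,|\mathcal{A}|=a}(-1)^{i-a}\binom{n-a}{i-a}z^{\lambda(C(\mathcal{A}))}.$$ $A^C_i=|\{v\in C : |\operatorname{supp}(v)|=i\}|$ is the number of codewords of Hamming weight $i$. *)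

theory Defs
  imports
    "HOL-Computational_Algebra.Polynomial"
    "HOL-Algebra.Module"
    "HOL-Algebra.QuotRing"
    "HOL-Library.Extended_Nat"
begin

locale local_cring = cring R + maximalideal \<mm> R
  for R (structure) and \<mm> +
  assumes maximalideal_unique: "maximalideal J R \<Longrightarrow> J = \<mm>"

text \<open>
  Vectors are functions on \<open>{1..n}\<close>, extended by \<^term>\<open>undefined\<close> elsewhere. The fields \<open>mult\<close> and
  \<open>one\<close> are present only because the module record extends the ring record.
\<close>

definition free_module :: "('a, 'b) ring_scheme \<Rightarrow> nat \<Rightarrow> ('a, nat \<Rightarrow> 'a) module" where
  "free_module R n =
    \<lparr>carrier = {1..n} \<rightarrow>\<^sub>E carrier R,
     mult = (\<lambda>v w. \<lambda>i\<in>{1..n}. v i \<otimes>\<^bsub>R\<^esub> w i),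
     one = (\<lambda>i\<in>{1..n}. \<one>\<^bsub>R\<^esub>),
     zero = (\<lambda>i\<in>{1..n}. \<zero>\<^bsub>R\<^esub>),
     add = (\<lambda>v w. \<lambda>i\<in>{1..n}. v i \<oplus>\<^bsub>R\<^esub> w i),
     smult = (\<lambda>r v. \<lambda>i\<in>{1..n}. r \<otimes>\<^bsub>R\<^esub> v i)\<rparr>"

lemma module_free_module:
  assumes "cring R"
  shows "module R (free_module R n)"
proof -
  interpret R: cring R by fact
  show ?thesis
  proof (rule moduleI)
    show "abelian_group (free_module R n)"
    proof (rule abelian_groupI)
      fix x assume x: "x \<in> carrier (free_module R n)"
      show "\<exists>y\<in>carrier (free_module R n).
        y \<oplus>\<^bsub>free_module R n\<^esub> x = \<zero>\<^bsub>free_module R n\<^esub>"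
        by (rule bexI[where x = "\<lambda>i\<in>{1..n}. \<ominus>\<^bsub>R\<^esub> x i"])
          (use x in \<open>auto simp: free_module_def PiE_iff R.l_neg intro!: ext\<close>)
    qed (auto simp: free_module_def PiE_iff extensional_def R.a_assoc R.a_comm R.a_lcomm intro!: ext)
  qed (use assms in \<open>auto simp: free_module_def PiE_iff extensional_def R.m_assoc
    R.l_distr R.r_distr intro!: ext\<close>)
qed

abbreviation linear_code :: "('a, 'b) ring_scheme \<Rightarrow> nat \<Rightarrow> (nat \<Rightarrow> 'a) set \<Rightarrow> bool" where
  "linear_code R n C \<equiv> submodule C R (free_module R n)"

definition supp :: "('a, 'b) ring_scheme \<Rightarrow> nat \<Rightarrow> (nat \<Rightarrow> 'a) \<Rightarrow> nat set" where
  "supp R n v = {i \<in> {1..n}. v i \<noteq> \<zero>\<^bsub>R\<^esub>}"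

definition supported_subcode ::
    "('a, 'b) ring_scheme \<Rightarrow> nat \<Rightarrow> (nat \<Rightarrow> 'a) set \<Rightarrow> nat set \<Rightarrow> (nat \<Rightarrow> 'a) set" where
  "supported_subcode R n C A = {v \<in> C. supp R n v \<subseteq> A}"

text \<open>The supremum of the lengths \<open>k\<close> of strict chains \<open>N 0 \<subset> \<dots> \<subset> N k\<close> of submodules.\<close>

definition module_length :: "('a, 'b) ring_scheme \<Rightarrow> ('a, 'c, 'd) module_scheme \<Rightarrow> enat" where
  "module_length R M =
    Sup {enat k | k. \<exists>N. (\<forall>j\<le>k. submodule (N j) R M) \<and> (\<forall>j<k. N j \<subset> N (Suc j))}"

text \<open>
  The exponent is meaningful only if the subcodes have finite length, since \<^term>\<open>the_enat \<infinity>\<close> is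
  unspecified; over a finite ring this is always the case.
\<close>

definition weight_polynomial ::
    "('a, 'b) ring_scheme \<Rightarrow> nat \<Rightarrow> (nat \<Rightarrow> 'a) set \<Rightarrow> nat \<Rightarrow> int poly" where
  "weight_polynomial R n C i =
    (\<Sum>a = 0..i. \<Sum>A | A \<subseteq> {1..n} \<and> card A = a.
      monom ((-1) ^ (i - a) * int ((n - a) choose (i - a)))
        (the_enat (module_length R
          (free_module R n\<lparr>carrier := supported_subcode R n C A\<rparr>))))"

definition num_codewords_of_weight ::
    "('a, 'b) ring_scheme \<Rightarrow> nat \<Rightarrow> (nat \<Rightarrow> 'a) set \<Rightarrow> nat \<Rightarrow> nat" where
  "num_codewords_of_weight R n C i = card {v \<in> C. card (supp R n v) = i}"

end

theory Submission
  imports Defs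
begin

text \<open>
  Write \<open>q\<close> for the size of the residue field. Over a finite local ring length is a logarithm of
  size: a finite module \<open>M\<close> of length \<open>l\<close> has exactly \<open>q ^ l\<close> elements
  (\<open>card_eq_power_module_length\<close>). This holds because a minimal submodule \<open>L\<close> strictly above \<open>N\<close>
  satisfies \<open>\<mm> L \<subseteq> N\<close>, by Nakayama's argument, so that \<open>L / N\<close> is a copy of the residue field
  (\<open>ex_submodule_above\<close>). Hence every strict inclusion of submodules multiplies the size by at
  least \<open>q\<close>, and some chain from \<open>0\<close> to \<open>M\<close> multiplies it by exactly \<open>q\<close> at each step.

  Evaluating the weight polynomial at \<open>q\<close> therefore turns every monomial into the number of
  codewords supported inside \<open>A\<close>. The binomial coefficient attached to \<open>A\<close> counts the sets \<open>B\<close> of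
  size \<open>i\<close> with \<open>A \<subseteq> B\<close>, so the double sum can be rearranged into one Moebius inversion over the
  subsets of each \<open>B\<close> (\<open>sum_binomial_eq_sum_supersets\<close>). The inversion for \<open>B\<close> yields the number of
  codewords with support exactly \<open>B\<close> (\<open>card_support_eq\<close>), and adding these over all \<open>B\<close> of size \<open>i\<close>
  counts the codewords of weight \<open>i\<close>.
\<close>

section \<open>Adjoining one element to a submodule\<close>

context module
begin

text \<open>
  The submodule \<open>N + R x\<close>, given as the image of an explicit map on \<open>R \<times> N\<close>, so that its size can be
  found by counting the fibres of that map.
\<close>

definition adjoin :: "'c set \<Rightarrow> 'c \<Rightarrow> 'c set" where
  "adjoin N x = (\<lambda>(r, u). u \<oplus>\<^bsub>M\<^esub> r \<odot>\<^bsub>M\<^esub> x) ` (carrier R \<times> N)"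

lemma submodule_zero: "submodule N R M \<Longrightarrow> \<zero>\<^bsub>M\<^esub> \<in> N"
  using subgroup.one_closed submodule.axioms(1) by fastforce

lemma submodule_adjoin:
  assumes N: "submodule N R M" and x: "x \<in> carrier M"
  shows "submodule (adjoin N x) R M"
proof (rule submoduleI)
  note NM = subsetD[OF submoduleE(1)[OF N]]
  show "adjoin N x \<subseteq> carrier M"
    using NM x by (auto simp: adjoin_def)
  have "\<zero>\<^bsub>M\<^esub> = \<zero>\<^bsub>M\<^esub> \<oplus>\<^bsub>M\<^esub> \<zero> \<odot>\<^bsub>M\<^esub> x"
    using x by simp
  then show "\<zero>\<^bsub>M\<^esub> \<in> adjoin N x"
    unfolding adjoin_def using submodule_zero[OF N] by (intro image_eqI[of _ _ "(\<zero>, \<zero>\<^bsub>M\<^esub>)"]) auto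
  fix a assume "a \<in> adjoin N x"
  then obtain r u where a: "r \<in> carrier R" "u \<in> N" "a = u \<oplus>\<^bsub>M\<^esub> r \<odot>\<^bsub>M\<^esub> x"
    by (auto simp: adjoin_def)
  have "\<ominus>\<^bsub>M\<^esub> a = \<ominus>\<^bsub>M\<^esub> u \<oplus>\<^bsub>M\<^esub> (\<ominus> r) \<odot>\<^bsub>M\<^esub> x"
    using a x NM by (simp add: smult_l_minus M.minus_add)
  then show "\<ominus>\<^bsub>M\<^esub> a \<in> adjoin N x"
    unfolding adjoin_def using a submoduleE(3)[OF N]
    by (intro image_eqI[of _ _ "(\<ominus> r, \<ominus>\<^bsub>M\<^esub> u)"]) auto
  show "s \<odot>\<^bsub>M\<^esub> a \<in> adjoin N x" if s: "s \<in> carrier R" for s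
  proof -
    have "s \<odot>\<^bsub>M\<^esub> a = s \<odot>\<^bsub>M\<^esub> u \<oplus>\<^bsub>M\<^esub> (s \<otimes> r) \<odot>\<^bsub>M\<^esub> x"
      using a x NM s by (simp add: smult_r_distr smult_assoc1)
    then show ?thesis
      unfolding adjoin_def using a s submoduleE(4)[OF N]
      by (intro image_eqI[of _ _ "(s \<otimes> r, s \<odot>\<^bsub>M\<^esub> u)"]) auto
  qed
  fix b assume "b \<in> adjoin N x"
  then obtain s v where b: "s \<in> carrier R" "v \<in> N" "b = v \<oplus>\<^bsub>M\<^esub> s \<odot>\<^bsub>M\<^esub> x"
    by (auto simp: adjoin_def)
  have "a \<oplus>\<^bsub>M\<^esub> b = (u \<oplus>\<^bsub>M\<^esub> v) \<oplus>\<^bsub>M\<^esub> (r \<oplus> s) \<odot>\<^bsub>M\<^esub> x"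
    using a b x NM by (simp add: smult_l_distr M.a_ac)
  then show "a \<oplus>\<^bsub>M\<^esub> b \<in> adjoin N x"
    unfolding adjoin_def using a b submoduleE(5)[OF N]
    by (intro image_eqI[of _ _ "(r \<oplus> s, u \<oplus>\<^bsub>M\<^esub> v)"]) auto
qed

lemma subset_adjoin:
  assumes N: "submodule N R M" and x: "x \<in> carrier M"
  shows "N \<subseteq> adjoin N x"
proof
  fix u assume "u \<in> N"
  moreover from this have "u \<oplus>\<^bsub>M\<^esub> \<zero> \<odot>\<^bsub>M\<^esub> x = u"
    using x submoduleE(1)[OF N] by auto
  ultimately show "u \<in> adjoin N x"
    unfolding adjoin_def by (intro image_eqI[of _ _ "(\<zero>, u)"]) auto
qed

lemma mem_adjoin:
  assumes N: "submodule N R M" and x: "x \<in> carrier M"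
  shows "x \<in> adjoin N x"
  unfolding adjoin_def using x submodule_zero[OF N]
  by (intro image_eqI[of _ _ "(\<one>, \<zero>\<^bsub>M\<^esub>)"]) auto

lemma adjoin_subset:
  assumes L: "submodule L R M" and "N \<subseteq> L" and x: "x \<in> L"
  shows "adjoin N x \<subseteq> L"
  unfolding adjoin_def using assms submoduleE(4,5)[OF L] by auto

end

section \<open>Finite modules over a finite local ring\<close>

text \<open>
  A non-unit generates a proper ideal, which lies in a proper ideal of largest size. The latter is
  maximal, hence equal to \<open>\<mm>\<close>. Finiteness of the ring takes the place of Zorn's lemma.
\<close>

lemma (in local_cring) unit_if_not_in_maximalideal:
  assumes "finite (carrier R)" and x: "x \<in> carrier R" "x \<notin> \<mm>"
  shows "x \<in> Units R"
proof -
  have "PIdl x = carrier R"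
  proof (rule ccontr)
    assume proper: "PIdl x \<noteq> carrier R"
    define P where "P = {J. ideal J R \<and> J \<noteq> carrier R \<and> PIdl x \<subseteq> J}"
    have "P \<subseteq> Pow (carrier R)"
      by (auto simp: P_def dest: ideal.Icarr)
    then have fin: "finite P"
      by (rule finite_subset) (simp add: assms(1))
    have mem: "PIdl x \<in> P"
      using proper cgenideal_ideal x(1) by (auto simp: P_def)
    from finite_has_maximal2[OF fin mem] obtain J
      where "J \<in> P" and max: "\<forall>J'\<in>P. J \<subseteq> J' \<longrightarrow> J = J'"
      by blast
    then have J: "ideal J R" "J \<noteq> carrier R" "PIdl x \<subseteq> J"
      by (auto simp: P_def)
    have "maximalideal J R"
    proof (rule maximalidealI)
      show "ideal J R" "carrier R \<noteq> J" using J by simp_all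
      show "J' = J \<or> J' = carrier R" if "ideal J' R" "J \<subseteq> J'" "J' \<subseteq> carrier R" for J'
        using max that J by (auto simp: P_def)
    qed
    then show False
      using maximalideal_unique J(3) cgenideal_self[OF x(1)] x(2) by auto
  qed
  then obtain y where "y \<in> carrier R" "\<one> = y \<otimes> x"
    unfolding cgenideal_def using one_closed by blast
  then show ?thesis
    using x(1) m_comm[OF x(1)] by (auto simp: Units_def intro!: bexI[of _ y])
qed

lemma (in local_cring) card_residue_field:
  assumes "finite (carrier R)"
  shows "card (carrier (R Quot \<mm>)) * card \<mm> = card (carrier R)"
  using a_lagrange[OF assms is_additive_subgroup]
  by (simp add: FactRing_def order_def)

locale finite_local_module =
  module R M + local_cring R \<mm>
  for R (structure) and \<mm> and M (structure) +
  assumes finite_ring: "finite (carrier R)"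
    and finite_module: "finite (carrier M)"
begin

abbreviation residue_card :: nat where
  "residue_card \<equiv> card (carrier (R Quot \<mm>))"

lemma finite_submodule: "submodule N R M \<Longrightarrow> finite N"
  using submoduleE(1) finite_module finite_subset by blast

text \<open>
  Nakayama's lemma for the cyclic module generated by \<open>x\<close> modulo \<open>N\<close>: an equation
  \<open>x = u + s a x\<close> with \<open>u \<in> N\<close> and \<open>a \<in> \<mm>\<close> says \<open>(1 - s a) x \<in> N\<close>, and \<open>1 - s a\<close> is a unit, so \<open>x\<close>
  would lie in \<open>N\<close>.
\<close>

lemma not_mem_adjoin_smult:
  assumes N: "submodule N R M" and x: "x \<in> carrier M" "x \<notin> N" and a: "a \<in> \<mm>"
  shows "x \<notin> adjoin N (a \<odot>\<^bsub>M\<^esub> x)"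
proof
  assume "x \<in> adjoin N (a \<odot>\<^bsub>M\<^esub> x)"
  then obtain s u where s: "s \<in> carrier R" and u: "u \<in> N"
    and x_eq: "x = u \<oplus>\<^bsub>M\<^esub> s \<odot>\<^bsub>M\<^esub> (a \<odot>\<^bsub>M\<^esub> x)"
    by (auto simp: adjoin_def)
  have aR: "a \<in> carrier R" using a by simp
  have uM: "u \<in> carrier M" using u submoduleE(1)[OF N] by auto
  let ?t = "\<one> \<oplus> \<ominus> (s \<otimes> a)"
  have sa: "s \<otimes> a \<in> \<mm>" using a s by (rule I_l_closed)
  have tR: "?t \<in> carrier R" using s aR by simp
  have "?t \<notin> \<mm>"
  proof
    assume "?t \<in> \<mm>"
    then have "?t \<oplus> s \<otimes> a \<in> \<mm>" using sa by simp
    moreover have "?t \<oplus> s \<otimes> a = \<one>"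
      using s aR by (simp add: R.a_assoc R.l_neg)
    ultimately show False
      using one_imp_carrier I_notcarr by simp
  qed
  then have unit: "?t \<in> Units R"
    using unit_if_not_in_maximalideal finite_ring tR by blast
  have "?t \<odot>\<^bsub>M\<^esub> x = x \<oplus>\<^bsub>M\<^esub> \<ominus>\<^bsub>M\<^esub> (s \<odot>\<^bsub>M\<^esub> (a \<odot>\<^bsub>M\<^esub> x))"
    using s aR x by (simp add: smult_l_distr smult_l_minus smult_assoc1)
  also have "\<dots> = u"
    using x_eq s aR x uM
    by (metis M.add.inv_solve_right M.add.m_closed smult_closed)
  finally have "inv ?t \<odot>\<^bsub>M\<^esub> (?t \<odot>\<^bsub>M\<^esub> x) \<in> N"
    using u unit submoduleE(4)[OF N] by auto
  moreover have "inv ?t \<odot>\<^bsub>M\<^esub> (?t \<odot>\<^bsub>M\<^esub> x) = x"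
    using unit x tR by (simp flip: smult_assoc1)
  ultimately show False using x by simp
qed

text \<open>
  The ideal of all \<open>a\<close> with \<open>a x \<in> N\<close> is exactly \<open>\<mm>\<close>: it contains \<open>\<mm>\<close> by hypothesis, and it contains no
  unit because \<open>x \<notin> N\<close>. So \<open>(N + R x) / N\<close> is isomorphic to the residue field. Quotient modules are
  avoided by counting the fibres of \<open>(r, u) \<mapsto> u + r x\<close> on \<open>R \<times> N\<close>: the fibre through \<open>(s, v)\<close> consists of
  the pairs \<open>(s + a, v - a x)\<close> with \<open>a \<in> \<mm>\<close>.
\<close>

lemma card_adjoin:
  assumes N: "submodule N R M" and x: "x \<in> carrier M" "x \<notin> N"
    and mx: "\<And>a. a \<in> \<mm> \<Longrightarrow> a \<odot>\<^bsub>M\<^esub> x \<in> N"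
  shows "card (adjoin N x) = residue_card * card N"
proof -
  note NM = subsetD[OF submoduleE(1)[OF N]]
  define f where "f = (\<lambda>(r, u). u \<oplus>\<^bsub>M\<^esub> r \<odot>\<^bsub>M\<^esub> x)"
  have colon: "a \<in> \<mm>" if "a \<in> carrier R" "a \<odot>\<^bsub>M\<^esub> x \<in> N" for a
  proof (rule ccontr)
    assume "a \<notin> \<mm>"
    then have unit: "a \<in> Units R"
      using unit_if_not_in_maximalideal finite_ring that by blast
    then have "inv a \<odot>\<^bsub>M\<^esub> (a \<odot>\<^bsub>M\<^esub> x) \<in> N"
      using that submoduleE(4)[OF N] by auto
    then show False
      using unit x that by (simp flip: smult_assoc1)
  qed
  have fibre: "card {p \<in> carrier R \<times> N. f p = y} = card \<mm>" if y: "y \<in> adjoin N x" for y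
  proof -
    obtain s v where s: "s \<in> carrier R" and v: "v \<in> N" and y_eq: "y = v \<oplus>\<^bsub>M\<^esub> s \<odot>\<^bsub>M\<^esub> x"
      using y by (auto simp: adjoin_def)
    let ?h = "\<lambda>a. (s \<oplus> a, v \<oplus>\<^bsub>M\<^esub> \<ominus>\<^bsub>M\<^esub> (a \<odot>\<^bsub>M\<^esub> x))"
    have sx: "s \<odot>\<^bsub>M\<^esub> x \<in> carrier M" using s x by simp
    have "{p \<in> carrier R \<times> N. f p = y} = ?h ` \<mm>"
    proof (intro equalityI subsetI)
      fix p assume "p \<in> {p \<in> carrier R \<times> N. f p = y}"
      then obtain r u where p: "p = (r, u)" and r: "r \<in> carrier R" and u: "u \<in> N"
        and "u \<oplus>\<^bsub>M\<^esub> r \<odot>\<^bsub>M\<^esub> x = y"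
        by (auto simp: f_def)
      define a where "a = \<ominus> s \<oplus> r"
      have a: "a \<in> carrier R" and r_eq: "r = s \<oplus> a"
        using r s by (simp_all add: a_def R.r_neg2)
      have ax: "a \<odot>\<^bsub>M\<^esub> x \<in> carrier M" using a x by simp
      have "(u \<oplus>\<^bsub>M\<^esub> a \<odot>\<^bsub>M\<^esub> x) \<oplus>\<^bsub>M\<^esub> s \<odot>\<^bsub>M\<^esub> x = v \<oplus>\<^bsub>M\<^esub> s \<odot>\<^bsub>M\<^esub> x"
        using \<open>u \<oplus>\<^bsub>M\<^esub> r \<odot>\<^bsub>M\<^esub> x = y\<close> NM[OF u] ax sx s a x
        by (simp add: y_eq r_eq smult_l_distr M.a_ac)
      then have v_eq: "v = u \<oplus>\<^bsub>M\<^esub> a \<odot>\<^bsub>M\<^esub> x"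
        using NM[OF u] NM[OF v] ax sx by (simp add: M.add.right_cancel)
      have "a \<odot>\<^bsub>M\<^esub> x = \<ominus>\<^bsub>M\<^esub> u \<oplus>\<^bsub>M\<^esub> v"
        using NM[OF u] ax by (simp add: v_eq M.r_neg1)
      then have "a \<in> \<mm>"
        using colon[OF a] u v submoduleE(3,5)[OF N] by simp
      moreover have "u = v \<oplus>\<^bsub>M\<^esub> \<ominus>\<^bsub>M\<^esub> (a \<odot>\<^bsub>M\<^esub> x)"
        using NM[OF u] ax by (simp add: v_eq M.a_assoc M.r_neg)
      ultimately show "p \<in> ?h ` \<mm>"
        using p r_eq by blast
    next
      fix p assume "p \<in> ?h ` \<mm>"
      then obtain a where a: "a \<in> \<mm>" and p: "p = ?h a" by blast
      have "f p = (v \<oplus>\<^bsub>M\<^esub> s \<odot>\<^bsub>M\<^esub> x) \<oplus>\<^bsub>M\<^esub> (\<ominus>\<^bsub>M\<^esub> (a \<odot>\<^bsub>M\<^esub> x) \<oplus>\<^bsub>M\<^esub> a \<odot>\<^bsub>M\<^esub> x)"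
        using NM[OF v] sx x a s by (simp add: p f_def smult_l_distr M.a_ac)
      also have "\<dots> = y"
        using NM[OF v] sx x a by (simp add: y_eq M.l_neg)
      finally show "p \<in> {p \<in> carrier R \<times> N. f p = y}"
        using s a v mx[OF a] submoduleE(3,5)[OF N] by (simp add: p)
    qed
    moreover have "inj_on ?h \<mm>"
      using s by (auto intro!: inj_onI)
    ultimately show ?thesis by (simp add: card_image)
  qed
  have "card (carrier R) * card N = card (carrier R \<times> N)"
    by (simp add: card_cartesian_product)
  also have "\<dots> = (\<Sum>y\<in>f ` (carrier R \<times> N). card {p \<in> carrier R \<times> N. f p = y})"
    using sum.image_gen[of "carrier R \<times> N" "\<lambda>_. 1::nat" f] finite_ring finite_submodule[OF N]
    by simp
  also have "f ` (carrier R \<times> N) = adjoin N x"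
    by (simp add: adjoin_def f_def)
  also have "(\<Sum>y\<in>adjoin N x. card {p \<in> carrier R \<times> N. f p = y}) = card (adjoin N x) * card \<mm>"
    using fibre by simp
  finally have "residue_card * card N * card \<mm> = card (adjoin N x) * card \<mm>"
    using card_residue_field[OF finite_ring] by (metis mult.assoc mult.commute)
  moreover have "card \<mm> \<noteq> 0"
    using finite_ring a_subset finite_subset by (metis card_eq_0_iff empty_iff additive_subgroup.zero_closed is_additive_subgroup)
  ultimately show ?thesis by simp
qed

text \<open>
  Choose \<open>L\<close> minimal among the submodules strictly above \<open>N\<close> and inside \<open>N'\<close>. By minimality every
  element of \<open>L\<close> outside \<open>N\<close> generates \<open>L\<close> over \<open>N\<close>. A multiple \<open>a x\<close> with \<open>a \<in> \<mm>\<close> cannot do so, by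
  Nakayama's argument, so it lies in \<open>N\<close>.
\<close>

lemma ex_submodule_above:
  assumes N: "submodule N R M" and N': "submodule N' R M" and "N \<subset> N'"
  obtains L where "submodule L R M" "N \<subset> L" "L \<subseteq> N'" "card L = residue_card * card N"
proof -
  define P where "P = {L. submodule L R M \<and> N \<subset> L \<and> L \<subseteq> N'}"
  have "P \<subseteq> Pow (carrier M)"
    using submoduleE(1) by (auto simp: P_def)
  then have fin: "finite P"
    by (rule finite_subset) (simp add: finite_module)
  have mem: "N' \<in> P"
    using assms by (simp add: P_def)
  from finite_has_minimal2[OF fin mem] obtain L
    where "L \<in> P" and min: "\<forall>L'\<in>P. L' \<subseteq> L \<longrightarrow> L = L'"
    by blast
  then have L: "submodule L R M" "N \<subset> L" "L \<subseteq> N'"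
    by (auto simp: P_def)
  from L(2) obtain x where x: "x \<in> L" "x \<notin> N" by blast
  have xM: "x \<in> carrier M" using x submoduleE(1)[OF L(1)] by blast
  have generate: "adjoin N y = L" if y: "y \<in> L" "y \<notin> N" for y
  proof -
    have yM: "y \<in> carrier M" using y submoduleE(1)[OF L(1)] by blast
    have "adjoin N y \<subseteq> L"
      using adjoin_subset[OF L(1)] L(2) y(1) by blast
    moreover have "N \<subset> adjoin N y"
      using subset_adjoin[OF N yM] mem_adjoin[OF N yM] y by blast
    moreover from calculation have "adjoin N y \<in> P"
      using submodule_adjoin[OF N yM] L(3) by (auto simp: P_def)
    ultimately show ?thesis
      using min by blast
  qed
  have "a \<odot>\<^bsub>M\<^esub> x \<in> N" if a: "a \<in> \<mm>" for a
    using generate[of "a \<odot>\<^bsub>M\<^esub> x"] not_mem_adjoin_smult[OF N xM x(2) a] x(1)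
      submoduleE(4)[OF L(1) Icarr[OF a] x(1)] by blast
  then have "card L = residue_card * card N"
    using card_adjoin[OF N xM x(2)] generate[OF x] by simp
  then show ?thesis by (rule that[OF L])
qed

lemma residue_card_ge_2: "residue_card \<ge> 2"
proof (rule ccontr)
  assume "\<not> ?thesis"
  moreover have "card \<mm> < card (carrier R)"
    using finite_ring a_subset I_notcarr by (simp add: psubset_card_mono psubset_eq)
  moreover have "residue_card = 0 \<or> residue_card = 1 \<or> residue_card \<ge> 2"
    by linarith
  ultimately show False
    using card_residue_field[OF finite_ring] by auto
qed

text \<open>
  This bounds the length of every chain from above. The witness of \<open>ex_submodule_above\<close> sits between two
  consecutive members of the chain, so each step multiplies the size by at least \<open>residue_card\<close>.
\<close>

lemma card_chain_ge:
  assumes "\<And>j. j \<le> k \<Longrightarrow> submodule (N j) R M" and "\<And>j. j < k \<Longrightarrow> N j \<subset> N (Suc j)"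
  shows "residue_card ^ k \<le> card (N k)"
  using assms
proof (induction k)
  case 0
  then show ?case
    using submoduleE(2)[OF 0(1)] finite_submodule[OF 0(1)] by (simp add: Suc_le_eq card_gt_0_iff)
next
  case (Suc k)
  have sub: "submodule (N k) R M" "submodule (N (Suc k)) R M" "N k \<subset> N (Suc k)"
    using Suc.prems(1)[of k] Suc.prems(1)[of "Suc k"] Suc.prems(2)[of k] by simp_all
  obtain L where L: "L \<subseteq> N (Suc k)" "card L = residue_card * card (N k)"
    using ex_submodule_above[OF sub] by metis
  have "residue_card ^ Suc k \<le> card L"
    using Suc.IH Suc.prems by (simp add: L(2))
  also have "\<dots> \<le> card (N (Suc k))"
    using L(1) finite_submodule[OF sub(2)] by (simp add: card_mono)
  finally show ?case .
qed

text \<open>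
  Iterating \<open>ex_submodule_above\<close> gives a chain whose steps all have index exactly \<open>residue_card\<close>.
\<close>

lemma ex_chain_to_carrier:
  assumes "submodule N R M"
  shows "\<exists>k F. F 0 = N \<and> (\<forall>j\<le>k. submodule (F j) R M) \<and> (\<forall>j<k. F j \<subset> F (Suc j)) \<and>
    card (carrier M) = residue_card ^ k * card N"
  using assms
proof (induction "card (carrier M) - card N" arbitrary: N rule: less_induct)
  case less
  show ?case
  proof (cases "N = carrier M")
    case True
    then show ?thesis
      using less.prems by (intro exI[of _ 0] exI[of _ "\<lambda>_. N"]) auto
  next
    case False
    then have "N \<subset> carrier M" using submoduleE(1)[OF less.prems] by blast
    from ex_submodule_above[OF less.prems carrier_is_submodule this] obtain L
      where L: "submodule L R M" "N \<subset> L" "card L = residue_card * card N"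
      by metis
    have "card N < card L" "card L \<le> card (carrier M)"
      using psubset_card_mono[OF finite_submodule[OF L(1)] L(2)]
        card_mono[OF finite_module submoduleE(1)[OF L(1)]] by simp_all
    then have "card (carrier M) - card L < card (carrier M) - card N" by linarith
    from less.hyps[OF this L(1)] obtain k F where F: "F 0 = L" "\<forall>j\<le>k. submodule (F j) R M" "\<forall>j<k. F j \<subset> F (Suc j)"
        "card (carrier M) = residue_card ^ k * card L"
      by metis
    let ?F = "case_nat N F"
    have "\<forall>j\<le>Suc k. submodule (?F j) R M" "\<forall>j<Suc k. ?F j \<subset> ?F (Suc j)"
      using F L less.prems by (auto split: nat.split simp: less_Suc_eq_le)
    moreover have "card (carrier M) = residue_card ^ Suc k * card N"
      using F(4) L(3) by simp
    ultimately show ?thesis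
      by (intro exI[of _ "Suc k"] exI[of _ ?F]) auto
  qed
qed

text \<open>
  A chain from \<open>0\<close> to \<open>M\<close> with all steps of index \<open>residue_card\<close> attains the bound that \<open>card_chain_ge\<close>
  imposes on all chains, so its number of steps is the length.
\<close>

theorem card_eq_power_module_length:
  "card (carrier M) = residue_card ^ the_enat (module_length R M)"
proof -
  have "submodule {\<zero>\<^bsub>M\<^esub>} R M"
    by (rule submoduleI) auto
  from ex_chain_to_carrier[OF this] obtain k F where F: "\<forall>j\<le>k. submodule (F j) R M"
      "\<forall>j<k. F j \<subset> F (Suc j)" and card: "card (carrier M) = residue_card ^ k"
    by auto
  have "module_length R M = enat k"
    unfolding module_length_def
  proof (rule antisym[OF Sup_least Sup_upper])
    fix l assume "l \<in> {enat k | k. \<exists>N. (\<forall>j\<le>k. submodule (N j) R M) \<and> (\<forall>j<k. N j \<subset> N (Suc j))}"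
    then obtain j N where l: "l = enat j" and N: "\<forall>i\<le>j. submodule (N i) R M" "\<forall>i<j. N i \<subset> N (Suc i)"
      by blast
    have "residue_card ^ j \<le> card (N j)"
      using N by (intro card_chain_ge) auto
    also have "\<dots> \<le> residue_card ^ k"
      unfolding card[symmetric] using N submoduleE(1) finite_module by (simp add: card_mono)
    finally show "l \<le> enat k"
      using residue_card_ge_2 l by simp
  qed (use F in blast)
  then show ?thesis using card by simp
qed

end

section \<open>Subcodes of prescribed support\<close>

text \<open>
  This makes \<open>card_eq_power_module_length\<close> applicable to the subcodes in the definition of the weight
  polynomial.
\<close>

lemma submodule_supported_subcode:
  assumes "cring R" and C: "linear_code R n C"
  shows "linear_code R n (supported_subcode R n C A)"
proof -
  interpret module R "free_module R n"
    using assms(1) by (rule module_free_module)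
  have smult: "r \<odot>\<^bsub>free_module R n\<^esub> v \<in> supported_subcode R n C A"
    if "r \<in> carrier R" "v \<in> supported_subcode R n C A" for r v
  proof -
    have "supp R n (r \<odot>\<^bsub>free_module R n\<^esub> v) \<subseteq> supp R n v"
      using that(1) by (auto simp: supp_def free_module_def)
    then show ?thesis
      using that submoduleE(4)[OF C] by (auto simp: supported_subcode_def)
  qed
  show ?thesis
  proof (rule submoduleI)
    show sub: "supported_subcode R n C A \<subseteq> carrier (free_module R n)"
      using submoduleE(1)[OF C] by (auto simp: supported_subcode_def)
    have "\<zero>\<^bsub>free_module R n\<^esub> \<in> C"
      using subgroup.one_closed submodule.axioms(1)[OF C] by fastforce
    then show "\<zero>\<^bsub>free_module R n\<^esub> \<in> supported_subcode R n C A"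
      by (auto simp: supported_subcode_def supp_def free_module_def)
    show "\<ominus>\<^bsub>free_module R n\<^esub> v \<in> supported_subcode R n C A"
      if "v \<in> supported_subcode R n C A" for v
      using smult[of "\<ominus>\<^bsub>R\<^esub> \<one>\<^bsub>R\<^esub>" v] that sub by (auto simp: smult_l_minus)
    show "v \<oplus>\<^bsub>free_module R n\<^esub> w \<in> supported_subcode R n C A"
      if v: "v \<in> supported_subcode R n C A" and w: "w \<in> supported_subcode R n C A" for v w
    proof -
      have "supp R n (v \<oplus>\<^bsub>free_module R n\<^esub> w) \<subseteq> supp R n v \<union> supp R n w"
        by (auto simp: supp_def free_module_def)
      then show ?thesis
        using v w submoduleE(5)[OF C] by (auto simp: supported_subcode_def)
    qed
  qed (rule smult)
qed

lemma card_supported_subcode: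
  assumes local: "local_cring R \<mm>" and fin: "finite (carrier R)" and C: "linear_code R n C"
  shows "card (supported_subcode R n C A) = card (carrier (R Quot \<mm>)) ^
    the_enat (module_length R (free_module R n\<lparr>carrier := supported_subcode R n C A\<rparr>))"
proof -
  interpret local_cring R \<mm> by fact
  note cring = is_cring
  have sub: "linear_code R n (supported_subcode R n C A)"
    using submodule_supported_subcode[OF cring C] .
  have "finite (carrier (free_module R n))"
    using fin by (auto simp: free_module_def intro: finite_PiE)
  then have "finite (supported_subcode R n C A)"
    using module.submoduleE(1)[OF module_free_module[OF cring] sub] finite_subset by blast
  then interpret finite_local_module R \<mm> "free_module R n\<lparr>carrier := supported_subcode R n C A\<rparr>"
    using submodule.submodule_is_module[OF sub module_free_module[OF cring]] fin local
    by (intro finite_local_module.intro finite_local_module_axioms.intro) auto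
  show ?thesis using card_eq_power_module_length by simp
qed

section \<open>Counting codewords by support\<close>

text \<open>
  With \<open>n\<close> the size of \<open>U\<close>, a subset of \<open>U\<close> of size \<open>a\<close> has \<open>(n - a) choose (i - a)\<close> supersets of size
  \<open>i\<close> in \<open>U\<close>. Replacing the binomial coefficient by a sum over these supersets and exchanging the two
  summations exhibits an alternating sum over subsets, to which Moebius inversion applies.
\<close>

lemma sum_binomial_eq_sum_supersets:
  fixes g :: "'a set \<Rightarrow> int"
  assumes U: "finite U"
  shows "(\<Sum>a = 0..i. \<Sum>A | A \<subseteq> U \<and> card A = a.
      (-1) ^ (i - a) * int ((card U - a) choose (i - a)) * g A) =
    (\<Sum>B | B \<subseteq> U \<and> card B = i. \<Sum>A\<in>Pow B. (-1) ^ (card B - card A) * g A)"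
proof -
  have supersets: "card {B. B \<subseteq> U \<and> card B = i \<and> A \<subseteq> B} = (card U - card A) choose (i - card A)"
    if A: "A \<subseteq> U" "card A \<le> i" for A
  proof -
    have finA: "finite A" using A U finite_subset by blast
    have "bij_betw (\<lambda>B. B - A) {B. B \<subseteq> U \<and> card B = i \<and> A \<subseteq> B}
        {D. D \<subseteq> U - A \<and> card D = i - card A}"
    proof (rule bij_betwI[where g = "\<lambda>D. D \<union> A"], goal_cases)
      case 1
      then show ?case using finA by (auto simp: card_Diff_subset)
    next
      case 2
      have "card (D \<union> A) = i" if D: "D \<subseteq> U - A" "card D = i - card A" for D
      proof -
        have "finite D" using U D(1) by (meson finite_Diff finite_subset)
        then have "card (D \<union> A) = card D + card A"
          using finA D(1) by (intro card_Un_disjoint) auto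
        then show ?thesis using D(2) A(2) by simp
      qed
      then show ?case using A by auto
    qed (use A in auto)
    then have "card {B. B \<subseteq> U \<and> card B = i \<and> A \<subseteq> B} = card {D. D \<subseteq> U - A \<and> card D = i - card A}"
      by (rule bij_betw_same_card)
    also have "\<dots> = (card U - card A) choose (i - card A)"
      using U finA A by (simp add: n_subsets card_Diff_subset)
    finally show ?thesis .
  qed
  have "(\<Sum>a = 0..i. \<Sum>A | A \<subseteq> U \<and> card A = a.
        (-1) ^ (i - a) * int ((card U - a) choose (i - a)) * g A) =
      (\<Sum>a = 0..i. \<Sum>A | A \<in> {A. A \<subseteq> U \<and> card A \<le> i} \<and> card A = a.
        (-1) ^ (i - card A) * int ((card U - card A) choose (i - card A)) * g A)"
    by (intro sum.cong) auto
  also have "\<dots> = (\<Sum>A | A \<subseteq> U \<and> card A \<le> i.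
        (-1) ^ (i - card A) * int ((card U - card A) choose (i - card A)) * g A)"
    using U by (intro sum.group) auto
  also have "\<dots> = (\<Sum>A | A \<subseteq> U \<and> card A \<le> i.
        \<Sum>B | B \<in> {B. B \<subseteq> U \<and> card B = i} \<and> A \<subseteq> B. (-1) ^ (card B - card A) * g A)"
    using supersets by (intro sum.cong) (auto simp: conj_assoc)
  also have "\<dots> = (\<Sum>B | B \<subseteq> U \<and> card B = i.
        \<Sum>A | A \<in> {A. A \<subseteq> U \<and> card A \<le> i} \<and> A \<subseteq> B. (-1) ^ (card B - card A) * g A)"
    using U by (intro sum.swap_restrict) auto
  also have "\<dots> = (\<Sum>B | B \<subseteq> U \<and> card B = i. \<Sum>A\<in>Pow B. (-1) ^ (card B - card A) * g A)"
    using U by (intro sum.cong refl) (auto intro: card_mono finite_subset)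
  finally show ?thesis .
qed

text \<open>
  Moebius inversion of the identity that counts the codewords supported inside \<open>S\<close> by their exact
  support \<open>T \<subseteq> S\<close>.
\<close>

lemma card_support_eq:
  assumes C: "finite C" and B: "finite B"
  shows "int (card {v \<in> C. supp R n v = B}) =
    (\<Sum>A\<in>Pow B. (-1) ^ (card B - card A) * int (card (supported_subcode R n C A)))"
proof (rule inclusion_exclusion_mobius[OF _ B])
  fix S :: "nat set" assume S: "finite S"
  define D where "D = supported_subcode R n C S"
  have "int (card D) = (\<Sum>v\<in>D. 1)"
    by simp
  also have "\<dots> = (\<Sum>T\<in>Pow S. \<Sum>v | v \<in> D \<and> supp R n v = T. 1)"
    using C S by (intro sum.group[symmetric]) (auto simp: D_def supported_subcode_def)
  also have "\<dots> = (\<Sum>T\<in>Pow S. int (card {v \<in> C. supp R n v = T}))"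
  proof (rule sum.cong[OF refl])
    fix T assume "T \<in> Pow S"
    then have "{v. v \<in> D \<and> supp R n v = T} = {v \<in> C. supp R n v = T}"
      by (auto simp: D_def supported_subcode_def)
    then show "(\<Sum>v | v \<in> D \<and> supp R n v = T. 1) = int (card {v \<in> C. supp R n v = T})"
      by simp
  qed
  finally show "int (card (supported_subcode R n C S)) =
      (\<Sum>T\<in>Pow S. int (card {v \<in> C. supp R n v = T}))"
    by (simp add: D_def)
qed

theorem proposition5p5:
  fixes R :: "('a, 'b) ring_scheme" and \<mm> :: "'a set" and q n i :: nat
    and C :: "(nat \<Rightarrow> 'a) set"
  assumes "local_cring R \<mm>"
    and "finite (carrier R)"
    and "q = card (carrier (R Quot \<mm>))"
    and "n \<ge> 1"
    and "linear_code R n C"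
    and "i \<le> n"
  shows "poly (weight_polynomial R n C i) (int q) = int (num_codewords_of_weight R n C i)"
proof -
  have "cring R" using assms(1) by (simp add: local_cring_def)
  have "finite (carrier (free_module R n))"
    using assms(2) by (auto simp: free_module_def intro: finite_PiE)
  then have C: "finite C"
    using module.submoduleE(1)[OF module_free_module[OF \<open>cring R\<close>] assms(5)] finite_subset by blast
  have "poly (weight_polynomial R n C i) (int q) =
      (\<Sum>a = 0..i. \<Sum>A | A \<subseteq> {1..n} \<and> card A = a.
        (-1) ^ (i - a) * int ((card {1..n} - a) choose (i - a)) *
          int (card (supported_subcode R n C A)))"
    unfolding weight_polynomial_def card_supported_subcode[OF assms(1,2,5)]
    by (simp add: poly_sum poly_monom assms(3))
  also have "\<dots> = (\<Sum>B | B \<subseteq> {1..n} \<and> card B = i. \<Sum>A\<in>Pow B.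
      (-1) ^ (card B - card A) * int (card (supported_subcode R n C A)))"
    by (intro sum_binomial_eq_sum_supersets) simp
  also have "\<dots> = (\<Sum>B | B \<subseteq> {1..n} \<and> card B = i. int (card {v \<in> C. supp R n v = B}))"
    using C by (intro sum.cong refl card_support_eq[symmetric]) (auto intro: finite_subset)
  also have "\<dots> = int (num_codewords_of_weight R n C i)"
  proof -
    let ?W = "{v \<in> C. card (supp R n v) = i}"
    have "(\<Sum>B | B \<subseteq> {1..n} \<and> card B = i. \<Sum>v | v \<in> ?W \<and> supp R n v = B. 1 :: int) = (\<Sum>v\<in>?W. 1)"
      using C by (intro sum.group) (auto simp: supp_def)
    moreover have "{v. v \<in> ?W \<and> supp R n v = B} = {v \<in> C. supp R n v = B}" if "card B = i" for B
      using that by auto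
    ultimately show ?thesis
      by (simp add: num_codewords_of_weight_def cong: conj_cong)
  qed
  finally show ?thesis .
qed

end
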